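(* Let $f:\mathbb R^d\to\mathbb R_{++}$ be one of the following functions: (1) $f(x)\equiv L$; (2) $f(x)=\log(c+\|x\|)$; (3) $f(x)=L+\|x\|^\nu$; (4) $f(x)=e^{\|x\|/r}$, with $c>1$, $L>0$, $\nu>0$ and $r>0$. Then $\log(f)$ is Lipschitz continuous on $\mathbb R^d$, and the induced set function $F:\mathcal P(\mathbb R^d)\to\mathbb R_{++}$, $F(\mathcal X)=\max\{f(x):x\in\mathcal X\}$, is RUC-regular.
   Context: $\mathcal P(\mathbb R^d)$ denotes the family of all nonempty compact subsets of $\mathbb R^d$. For compact sets $\mathcal X,\mathcal Y$ the Hausdorff distance is $d_{\rm H}(\mathcal X,\mathcal Y)=\max\{\max_{x\in\mathcal X}\min_{y\in\mathcal Y}\|x-y\|,\ \max_{y\in\mathcal Y}\min_{x\in\mathcal X}\|x-y\|\}$, where $\|\cdot\|$ is a fixed norm (the Euclidean norm by default). A positive-valued set function $F:\mathcal P(\mathbb R^d)\to\mathbb R_{++}$ is called relative uniform continuous (RUC-regular) if for every $\epsilon>0$ there exists $\delta>0$ such that $\left|1-\max\left\{\frac{F(\mathcal X)}{F(\mathcal Y)},\frac{F(\mathcal Y)}{F(\mathcal X)}\right\}\right|\le\epsilon$ for all $\mathcal X,\mathcal Y\in\mathcal P(\mathbb R^d)$ with $d_{\rm H}(\mathcal X,\mathcal Y)\le\delta$.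
   Formalization: The Lipschitz claim for log(f) is not made in case (3) with ν<1, where it is false because log(L+‖x‖^ν) has unbounded slope at the origin; RUC-regularity of F is still claimed in all four cases and for all ν>0. *)

theory Defs
  imports "HOL-Analysis.Analysis" "HOL-Real_Asymp.Real_Asymp"
begin

definition is_norm :: "('a::real_vector \<Rightarrow> real) \<Rightarrow> bool" where
  "is_norm N \<longleftrightarrow>
     (\<forall>x. N x = 0 \<longleftrightarrow> x = 0) \<and>
     (\<forall>a x. N (a *\<^sub>R x) = \<bar>a\<bar> * N x) \<and>
     (\<forall>x y. N (x + y) \<le> N x + N y)"

lemma is_norm_norm: "is_norm (norm :: 'a::real_normed_vector \<Rightarrow> real)"
  by (simp add: is_norm_def norm_triangle_ineq)

definition lipschitz_wrt :: "('a::real_vector \<Rightarrow> real) \<Rightarrow> ('a \<Rightarrow> real) \<Rightarrow> bool" where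
  "lipschitz_wrt N g \<longleftrightarrow> (\<exists>C\<ge>0. \<forall>x y. \<bar>g x - g y\<bar> \<le> C * N (x - y))"

lemma lipschitz_wrt_norm_iff:
  fixes g :: "'a::real_normed_vector \<Rightarrow> real"
  shows "lipschitz_wrt norm g \<longleftrightarrow> (\<exists>C. C-lipschitz_on UNIV g)"
  by (auto simp: lipschitz_wrt_def lipschitz_on_def dist_norm)

text \<open>Compactness in \<open>real ^ 'd\<close> does not depend on the choice of the norm.\<close>

definition nonempty_compacts :: "(real ^ 'd) set set" where
  "nonempty_compacts = {X. compact X \<and> X \<noteq> {}}"

text \<open>Maxima and minima are genuine ones: the value is unspecified if the extremum is not attained.\<close>

definition hausdorff_dist ::
    "(real ^ 'd \<Rightarrow> real) \<Rightarrow> (real ^ 'd) set \<Rightarrow> (real ^ 'd) set \<Rightarrow> real" where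
  "hausdorff_dist N X Y =
     max (GREATEST m. m \<in> (\<lambda>x. LEAST d. d \<in> (\<lambda>y. N (x - y)) ` Y) ` X)
         (GREATEST m. m \<in> (\<lambda>y. LEAST d. d \<in> (\<lambda>x. N (x - y)) ` X) ` Y)"

definition max_set_fun :: "(real ^ 'd \<Rightarrow> real) \<Rightarrow> (real ^ 'd) set \<Rightarrow> real" where
  "max_set_fun f X = (GREATEST m. m \<in> f ` X)"

text \<open>The first conjunct says that \<open>F\<close> maps the nonempty compact sets into the positive reals.\<close>

definition RUC_regular :: "(real ^ 'd \<Rightarrow> real) \<Rightarrow> ((real ^ 'd) set \<Rightarrow> real) \<Rightarrow> bool" where
  "RUC_regular N F \<longleftrightarrow>
     (\<forall>X\<in>nonempty_compacts. F X > 0) \<and>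
     (\<forall>\<epsilon>>0. \<exists>\<delta>>0. \<forall>X\<in>nonempty_compacts. \<forall>Y\<in>nonempty_compacts.
        hausdorff_dist N X Y \<le> \<delta> \<longrightarrow> \<bar>1 - max (F X / F Y) (F Y / F X)\<bar> \<le> \<epsilon>)"

text \<open>For \<open>\<nu> < 1\<close> the logarithm of \<open>L + \<parallel>x\<parallel>\<^sup>\<nu>\<close> has unbounded slope at the origin, so it is not Lipschitz.\<close>

lemma not_lipschitz_power_weight:
  fixes N :: "real ^ 'd \<Rightarrow> real"
  assumes N: "is_norm N" and "L > 0" "0 < \<nu>" "\<nu> < 1"
  shows "\<not> lipschitz_wrt N (\<lambda>x. ln (L + N x powr \<nu>))"
proof
  assume "lipschitz_wrt N (\<lambda>x. ln (L + N x powr \<nu>))"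
  then obtain C where C: "\<And>x y. \<bar>ln (L + N x powr \<nu>) - ln (L + N y powr \<nu>)\<bar> \<le> C * N (x - y)"
    unfolding lipschitz_wrt_def by blast
  define u :: "real ^ 'd" where "u = axis undefined 1"
  define a where "a = N u"
  have sc: "N (s *\<^sub>R u) = s * a" if "s > 0" for s
    using N that by (simp add: is_norm_def a_def)
  have N0: "N 0 = 0" using N by (simp add: is_norm_def)
  have "u \<noteq> 0" by (simp add: u_def)
  then have a0: "a \<noteq> 0" using N by (simp add: is_norm_def a_def)
  have "0 = N (u + (-1) *\<^sub>R u)" by (simp add: N0)
  also have "\<dots> \<le> N u + N ((-1) *\<^sub>R u)" using N unfolding is_norm_def by blast
  also have "N ((-1) *\<^sub>R u) = \<bar>-1\<bar> * N u" using N unfolding is_norm_def by blast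
  finally have "a > 0" using a0 by (simp add: a_def)
  have bd: "(ln (L + t powr \<nu>) - ln L) / t \<le> C" if "t > 0" for t
    using C[of "(t / a) *\<^sub>R u" 0] sc[of "t / a"] that \<open>a > 0\<close> \<open>0 < \<nu>\<close>
    by (simp add: N0 divide_le_eq)
  have "filterlim (\<lambda>t. (ln (L + t powr \<nu>) - ln L) / t) at_top (at_right 0)"
    using assms by real_asymp
  then have "\<forall>\<^sub>F t in at_right 0. (ln (L + t powr \<nu>) - ln L) / t > C"
    by (simp add: filterlim_at_top_dense)
  moreover have "\<forall>\<^sub>F t::real in at_right 0. t > 0"
    by (simp add: eventually_at_right_less)
  ultimately have "\<forall>\<^sub>F t::real in at_right 0. False"
    by eventually_elim (use bd in force)
  then show False by simp
qed

end

theory Submission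
  imports Defs
begin

text \<open>
  If \<open>ln f\<close> is uniformly continuous, a maximiser \<open>x\<close> of \<open>f\<close> on \<open>X\<close> has a point \<open>y \<in> Y\<close> within the
  Hausdorff distance, so \<open>ln (F X) = ln (f x) \<le> ln (f y) + \<epsilon> \<le> ln (F Y) + \<epsilon>\<close>, and symmetrically;
  hence the quotients \<open>F X / F Y\<close> lie between \<open>exp (- \<epsilon>)\<close> and \<open>exp \<epsilon>\<close>. Each weight is a function of
  \<open>N x\<close>, so the uniform continuity is a one-dimensional matter: the logarithmic derivatives are
  bounded, except for \<open>L + t powr \<nu>\<close> with \<open>\<nu> < 1\<close>, which is Hoelder continuous and bounded below.
\<close>

section \<open>Norms and the Hausdorff distance\<close>

lemma is_norm_zero: "is_norm N \<Longrightarrow> N 0 = 0"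
  by (simp add: is_norm_def)

lemma is_norm_triangle: "is_norm N \<Longrightarrow> N (x + y) \<le> N x + N y"
  by (simp add: is_norm_def)

lemma is_norm_minus_commute:
  assumes "is_norm N"
  shows "N (x - y) = N (y - x)"
proof -
  have "N ((-1) *\<^sub>R (y - x)) = \<bar>-1\<bar> * N (y - x)"
    using assms unfolding is_norm_def by blast
  then show ?thesis by simp
qed

lemma is_norm_nonneg:
  assumes "is_norm N"
  shows "N x \<ge> 0"
  using is_norm_triangle[OF assms, of x "- x"] is_norm_minus_commute[OF assms, of 0 x]
    is_norm_zero[OF assms] by simp

lemma is_norm_reverse_triangle:
  assumes "is_norm N"
  shows "\<bar>N x - N y\<bar> \<le> N (x - y)"
  using is_norm_triangle[OF assms, of "x - y" y] is_norm_triangle[OF assms, of "y - x" x]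
    is_norm_minus_commute[OF assms, of x y] by simp

lemma is_norm_convex_on:
  assumes "is_norm N"
  shows "convex_on UNIV N"
proof (rule convex_onI)
  fix t :: real and x y
  assume t: "0 < t" "t < 1"
  have "N ((1 - t) *\<^sub>R x + t *\<^sub>R y) \<le> N ((1 - t) *\<^sub>R x) + N (t *\<^sub>R y)"
    by (rule is_norm_triangle[OF assms])
  also have "\<dots> = (1 - t) * N x + t * N y"
    using assms t by (simp add: is_norm_def)
  finally show "N ((1 - t) *\<^sub>R x + t *\<^sub>R y) \<le> (1 - t) * N x + t * N y" .
qed simp

text \<open>A finite convex function on a finite-dimensional space is continuous, so convexity gives
  continuity without a comparison of \<open>N\<close> with the Euclidean norm.\<close>

lemma is_norm_continuous_on:
  fixes N :: "'a::euclidean_space \<Rightarrow> real"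
  assumes "is_norm N"
  shows "continuous_on S N"
  using convex_on_continuous[OF open_UNIV is_norm_convex_on[OF assms]]
  by (rule continuous_on_subset) simp

text \<open>Distances are measured by \<open>N\<close>, as in \<open>hausdorff_dist\<close>, and the
  inequalities are non-strict to match \<open>RUC_regular\<close>.\<close>

definition uniformly_continuous_wrt :: "('a::real_vector \<Rightarrow> real) \<Rightarrow> ('a \<Rightarrow> real) \<Rightarrow> bool" where
  "uniformly_continuous_wrt N g \<longleftrightarrow>
     (\<forall>\<epsilon>>0. \<exists>\<delta>>0. \<forall>x y. N (x - y) \<le> \<delta> \<longrightarrow> \<bar>g x - g y\<bar> \<le> \<epsilon>)"

lemma lipschitz_wrt_imp_uniformly_continuous_wrt:
  assumes "is_norm N" "lipschitz_wrt N g"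
  shows "uniformly_continuous_wrt N g"
  unfolding uniformly_continuous_wrt_def
proof (intro allI impI)
  fix \<epsilon> :: real
  assume "\<epsilon> > 0"
  obtain C where C: "C \<ge> 0" "\<And>x y. \<bar>g x - g y\<bar> \<le> C * N (x - y)"
    using assms(2) unfolding lipschitz_wrt_def by blast
  \<comment> \<open>Dividing by \<open>C + 1\<close> instead of \<open>C\<close> covers
    \<open>C = 0\<close>.\<close>
  have "\<bar>g x - g y\<bar> \<le> \<epsilon>" if "N (x - y) \<le> \<epsilon> / (C + 1)" for x y
  proof -
    have "C * N (x - y) \<le> (C + 1) * N (x - y)"
      using is_norm_nonneg[OF assms(1)] by (intro mult_right_mono) auto
    also have "\<dots> \<le> \<epsilon>" using that C(1) by (simp add: field_simps)
    finally show ?thesis using C(2)[of x y] by linarith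
  qed
  moreover have "\<epsilon> / (C + 1) > 0" using \<open>\<epsilon> > 0\<close> C(1) by simp
  ultimately show "\<exists>\<delta>>0. \<forall>x y. N (x - y) \<le> \<delta> \<longrightarrow> \<bar>g x - g y\<bar> \<le> \<epsilon>" by blast
qed

text \<open>Continuity of \<open>N\<close> at 0 makes every \<open>N\<close>-ball a neighbourhood in
  the usual topology, so closeness in \<open>N\<close> can be replaced by topological
  closeness.\<close>

lemma uniformly_continuous_wrt_imp_continuous_on:
  fixes N :: "'a::euclidean_space \<Rightarrow> real"
  assumes N: "is_norm N" and g: "uniformly_continuous_wrt N g"
  shows "continuous_on S g"
proof -
  have "(g \<longlongrightarrow> g a) (at a)" for a
  proof (rule tendstoI)
    fix e :: real
    assume "e > 0"
    then obtain d where d: "d > 0" "\<And>x y. N (x - y) \<le> d \<Longrightarrow> \<bar>g x - g y\<bar> \<le> e / 2"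
      using g unfolding uniformly_continuous_wrt_def by (meson half_gt_zero)
    have "isCont N 0"
      using is_norm_continuous_on[OF N, of UNIV] by (simp add: continuous_on_eq_continuous_at)
    then have "isCont (\<lambda>x. N (x - a)) a"
      by (intro isCont_o2[where f = "\<lambda>x. x - a" and g = N]) auto
    then have "((\<lambda>x. N (x - a)) \<longlongrightarrow> 0) (at a)"
      by (simp add: isCont_def is_norm_zero[OF N])
    then have "\<forall>\<^sub>F x in at a. N (x - a) < d"
      using d(1) by (rule order_tendstoD(2))
    then show "\<forall>\<^sub>F x in at a. dist (g x) (g a) < e"
    proof eventually_elim
      case (elim x)
      then show ?case using d(2)[of x a] \<open>e > 0\<close> by (simp add: dist_real_def)
    qed
  qed
  then show ?thesis
    by (simp add: continuous_at_imp_continuous_on isCont_def)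
qed

section \<open>Attained extrema and the Hausdorff distance\<close>

lemma Greatest_image_attained:
  fixes f :: "'a::topological_space \<Rightarrow> real"
  assumes "compact X" "X \<noteq> {}" "continuous_on X f"
  shows "\<exists>x\<in>X. (GREATEST m. m \<in> f ` X) = f x \<and> (\<forall>y\<in>X. f y \<le> f x)"
proof -
  obtain x where x: "x \<in> X" "\<forall>y\<in>X. f y \<le> f x"
    using continuous_attains_sup[OF assms] by blast
  then have "(GREATEST m. m \<in> f ` X) = f x"
    by (intro Greatest_equality) auto
  with x show ?thesis by blast
qed

lemma Least_image_attained:
  fixes f :: "'a::topological_space \<Rightarrow> real"
  assumes "compact X" "X \<noteq> {}" "continuous_on X f"
  shows "\<exists>x\<in>X. (LEAST m. m \<in> f ` X) = f x \<and> (\<forall>y\<in>X. f x \<le> f y)"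
proof -
  obtain x where x: "x \<in> X" "\<forall>y\<in>X. f x \<le> f y"
    using continuous_attains_inf[OF assms] by blast
  then have "(LEAST m. m \<in> f ` X) = f x"
    by (intro Least_equality) auto
  with x show ?thesis by blast
qed

text \<open>The distance to \<open>Y\<close> is attained for each point and is 1-Lipschitz in that
  point. Hence it is continuous and its maximum over the compact set \<open>X\<close> exists; this
  maximum bounds the distance from \<open>x\<close> to its nearest point in
  \<open>Y\<close>.\<close>

lemma one_sided_hausdorff_dist_attained:
  fixes N :: "'a::euclidean_space \<Rightarrow> real"
  assumes N: "is_norm N" and X: "compact X" "X \<noteq> {}" and Y: "compact Y" "Y \<noteq> {}"
    and x: "x \<in> X"
  shows "\<exists>y\<in>Y. N (x - y) \<le> (GREATEST m. m \<in> (\<lambda>x. LEAST d. d \<in> (\<lambda>y. N (x - y)) ` Y) ` X)"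
proof -
  define D where "D x = (LEAST d. d \<in> (\<lambda>y. N (x - y)) ` Y)" for x
  have att: "\<exists>y\<in>Y. D z = N (z - y) \<and> (\<forall>y'\<in>Y. N (z - y) \<le> N (z - y'))" for z
    unfolding D_def
    by (intro Least_image_attained[OF Y] continuous_on_compose2[OF is_norm_continuous_on[OF N, of UNIV]]
        continuous_intros) auto
  \<comment> \<open>A nearest point of \<open>b\<close> is a competitor for
    \<open>a\<close>.\<close>
  have le: "D a \<le> D b + N (a - b)" for a b
  proof -
    obtain y where y: "y \<in> Y" "D b = N (b - y)" using att by blast
    have "D a \<le> N (a - y)" using att[of a] y(1) by auto
    also have "\<dots> \<le> N (a - b) + N (b - y)"
      using is_norm_triangle[OF N, of "a - b" "b - y"] by simp
    finally show ?thesis using y by simp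
  qed
  have "\<bar>D a - D b\<bar> \<le> 1 * N (a - b)" for a b
    using le[of a b] le[of b a] is_norm_minus_commute[OF N, of a b] by simp
  then have "lipschitz_wrt N D"
    unfolding lipschitz_wrt_def using zero_le_one by blast
  then have "continuous_on X D"
    by (intro uniformly_continuous_wrt_imp_continuous_on[OF N]
        lipschitz_wrt_imp_uniformly_continuous_wrt[OF N])
  then have "D x \<le> (GREATEST m. m \<in> D ` X)"
    using Greatest_image_attained[OF X] x by force
  then show ?thesis using att[of x] unfolding D_def by force
qed

lemma hausdorff_dist_nearby:
  assumes "is_norm N" "X \<in> nonempty_compacts" "Y \<in> nonempty_compacts"
  shows "x \<in> X \<Longrightarrow> \<exists>y\<in>Y. N (x - y) \<le> hausdorff_dist N X Y"
    and "y \<in> Y \<Longrightarrow> \<exists>x\<in>X. N (y - x) \<le> hausdorff_dist N X Y"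
proof -
  have X: "compact X" "X \<noteq> {}" and Y: "compact Y" "Y \<noteq> {}"
    using assms(2,3) by (auto simp: nonempty_compacts_def)
  show "\<exists>y\<in>Y. N (x - y) \<le> hausdorff_dist N X Y" if "x \<in> X"
    using one_sided_hausdorff_dist_attained[OF assms(1) X Y that]
    unfolding hausdorff_dist_def by (meson max.coboundedI1)
  \<comment> \<open>In the second term of \<open>hausdorff_dist\<close> the point of
    \<open>Y\<close> is the subtrahend, so symmetry of \<open>N\<close> is needed before the
    one-sided result applies with the sets exchanged.\<close>
  show "\<exists>x\<in>X. N (y - x) \<le> hausdorff_dist N X Y" if "y \<in> Y"
    using one_sided_hausdorff_dist_attained[OF assms(1) Y X that]
    unfolding hausdorff_dist_def
    by (subst is_norm_minus_commute[OF assms(1)]) (meson max.coboundedI2)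
qed

lemma max_set_fun_attained:
  assumes "continuous_on UNIV f" "X \<in> nonempty_compacts"
  shows "\<exists>x\<in>X. max_set_fun f X = f x \<and> (\<forall>y\<in>X. f y \<le> f x)"
  using assms Greatest_image_attained[of X f] continuous_on_subset[OF assms(1), of X]
  unfolding nonempty_compacts_def max_set_fun_def by blast

section \<open>From uniform continuity of the logarithm to regularity\<close>

lemma max_ratio_bound:
  fixes a b \<epsilon> :: real
  assumes "a > 0" "b > 0" "\<epsilon> > 0" and le: "\<bar>ln a - ln b\<bar> \<le> ln (1 + \<epsilon>)"
  shows "\<bar>1 - max (a / b) (b / a)\<bar> \<le> \<epsilon>"
proof -
  have "ln (a / b) \<le> ln (1 + \<epsilon>)" "ln (b / a) \<le> ln (1 + \<epsilon>)"
    using assms by (simp_all add: ln_div)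
  then have "a / b \<le> 1 + \<epsilon>" "b / a \<le> 1 + \<epsilon>"
    using assms by (simp_all del: ln_div)
  \<comment> \<open>The quotients are reciprocal, so the larger one is at least 1 and the absolute
    value is the maximum minus 1.\<close>
  moreover have "1 \<le> max (a / b) (b / a)"
    using assms by (auto simp: le_max_iff_disj)
  ultimately show ?thesis by auto
qed

lemma RUC_regular_max_set_fun:
  fixes N f :: "real ^ 'd \<Rightarrow> real"
  assumes N: "is_norm N" and pos: "\<And>x. f x > 0"
    and uc: "uniformly_continuous_wrt N (\<lambda>x. ln (f x))"
  shows "RUC_regular N (max_set_fun f)"
proof -
  \<comment> \<open>Continuity of \<open>f\<close> itself is recovered from that of its logarithm by
    exponentiating.\<close>
  have "continuous_on UNIV (\<lambda>x. exp (ln (f x)))"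
    by (intro continuous_intros uniformly_continuous_wrt_imp_continuous_on[OF N uc])
  then have cont: "continuous_on UNIV f" using pos by simp
  note max = max_set_fun_attained[OF cont]
  have maxpos: "max_set_fun f X > 0" if "X \<in> nonempty_compacts" for X
    using max[OF that] pos by force
  have "\<exists>\<delta>>0. \<forall>X\<in>nonempty_compacts. \<forall>Y\<in>nonempty_compacts. hausdorff_dist N X Y \<le> \<delta> \<longrightarrow>
      \<bar>1 - max (max_set_fun f X / max_set_fun f Y) (max_set_fun f Y / max_set_fun f X)\<bar> \<le> \<epsilon>"
    if "\<epsilon> > 0" for \<epsilon>
  proof -
    \<comment> \<open>A logarithmic tolerance of \<open>ln (1 + \<epsilon>)\<close> allows quotients
      up to exactly \<open>1 + \<epsilon>\<close>.\<close>
    have "ln (1 + \<epsilon>) > 0" using that by simp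
    then obtain \<delta> where \<delta>: "\<delta> > 0"
        "\<And>x y. N (x - y) \<le> \<delta> \<Longrightarrow> \<bar>ln (f x) - ln (f y)\<bar> \<le> ln (1 + \<epsilon>)"
      using uc unfolding uniformly_continuous_wrt_def by meson
    have one: "ln (max_set_fun f X) - ln (max_set_fun f Y) \<le> ln (1 + \<epsilon>)"
      if XY: "X \<in> nonempty_compacts" "Y \<in> nonempty_compacts"
        and near: "\<And>x. x \<in> X \<Longrightarrow> \<exists>y\<in>Y. N (x - y) \<le> \<delta>" for X Y
    proof -
      obtain x where x: "x \<in> X" "max_set_fun f X = f x" using max[OF XY(1)] by blast
      obtain y where y: "y \<in> Y" "N (x - y) \<le> \<delta>" using near x(1) by blast
      have "f y \<le> max_set_fun f Y" using max[OF XY(2)] y(1) by force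
      then have "ln (f y) \<le> ln (max_set_fun f Y)" using pos[of y] by simp
      then show ?thesis using \<delta>(2)[OF y(2)] unfolding x(2) by linarith
    qed
    have "\<bar>1 - max (max_set_fun f X / max_set_fun f Y) (max_set_fun f Y / max_set_fun f X)\<bar> \<le> \<epsilon>"
      if XY: "X \<in> nonempty_compacts" "Y \<in> nonempty_compacts" and "hausdorff_dist N X Y \<le> \<delta>" for X Y
    proof (rule max_ratio_bound)
      note near = hausdorff_dist_nearby[OF N XY]
      have "ln (max_set_fun f X) - ln (max_set_fun f Y) \<le> ln (1 + \<epsilon>)"
        by (rule one[OF XY]) (use near(1) that(3) in force)
      moreover have "ln (max_set_fun f Y) - ln (max_set_fun f X) \<le> ln (1 + \<epsilon>)"
        by (rule one[OF XY(2,1)]) (use near(2) that(3) in force)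
      ultimately show "\<bar>ln (max_set_fun f X) - ln (max_set_fun f Y)\<bar> \<le> ln (1 + \<epsilon>)" by linarith
    qed (use XY maxpos \<open>\<epsilon> > 0\<close> in auto)
    then show ?thesis using \<delta>(1) by blast
  qed
  then show ?thesis unfolding RUC_regular_def using maxpos by blast
qed

section \<open>The weights as functions of the norm\<close>

text \<open>The mean value theorem makes \<open>g\<close> Lipschitz on the half-line, and the
  reverse triangle inequality carries this over to \<open>N\<close>. Since the theorem uses
  derivatives only at interior points, continuity suffices at 0, where a power may fail to be
  differentiable.\<close>

lemma lipschitz_wrt_compose_norm:
  assumes N: "is_norm N"
    and cont: "continuous_on {0..} g"
    and deriv: "\<And>t. t > 0 \<Longrightarrow> (g has_real_derivative g' t) (at t)"
    and bound: "\<And>t. t > 0 \<Longrightarrow> \<bar>g' t\<bar> \<le> C"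
  shows "lipschitz_wrt N (\<lambda>x. g (N x))"
proof -
  have C: "C \<ge> 0" using bound[of 1] by simp
  have less: "\<bar>g t - g s\<bar> \<le> C * (t - s)" if "0 \<le> s" "s < t" for s t
  proof -
    have "continuous_on {s..t} g" using cont by (rule continuous_on_subset) (use that in auto)
    moreover have "g differentiable (at u)" if "s < u" "u < t" for u
      using deriv[of u] that \<open>0 \<le> s\<close> by (auto simp: real_differentiable_def)
    ultimately obtain l u where u: "s < u" "u < t" "DERIV g u :> l" "g t - g s = (t - s) * l"
      using MVT[of s t g] \<open>s < t\<close> by blast
    have "l = g' u" using DERIV_unique[OF u(3) deriv] u(1) \<open>0 \<le> s\<close> by simp
    then show ?thesis using bound[of u] u that by (simp add: abs_mult mult.commute)
  qed
  have "\<bar>g (N x) - g (N y)\<bar> \<le> C * \<bar>N x - N y\<bar>" for x y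
    using less[of "N x" "N y"] less[of "N y" "N x"] is_norm_nonneg[OF N]
    by (cases "N x" "N y" rule: linorder_cases) (auto simp: abs_minus_commute)
  moreover have "C * \<bar>N x - N y\<bar> \<le> C * N (x - y)" for x y
    by (intro mult_left_mono is_norm_reverse_triangle[OF N] C)
  ultimately show ?thesis unfolding lipschitz_wrt_def using C order_trans by blast
qed

lemma lipschitz_wrt_ln_ln:
  assumes N: "is_norm N" and c: "(c::real) > 1"
  shows "lipschitz_wrt N (\<lambda>x. ln (ln (c + N x)))"
proof (rule lipschitz_wrt_compose_norm[OF N])
  show "continuous_on {0..} (\<lambda>t. ln (ln (c + t)))"
    using c by (intro continuous_intros) (auto simp: ln_eq_zero_iff)
  fix t :: real
  assume t: "t > 0"
  show "((\<lambda>t. ln (ln (c + t))) has_real_derivative 1 / (ln (c + t) * (c + t))) (at t)"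
    using c t by (auto intro!: derivative_eq_intros simp: field_simps)
  \<comment> \<open>Both factors grow with \<open>t\<close>, so the derivative is largest in the
    limit at 0; \<open>c > 1\<close> keeps \<open>ln c\<close> positive.\<close>
  have "ln c * c \<le> ln (c + t) * (c + t)"
    using c t by (intro mult_mono) auto
  then show "\<bar>1 / (ln (c + t) * (c + t))\<bar> \<le> 1 / (ln c * c)"
    using c t by (simp add: frac_le)
qed

lemma lipschitz_wrt_ln_power_weight:
  assumes N: "is_norm N" and L: "(L::real) > 0" and \<nu>: "\<nu> \<ge> 1"
  shows "lipschitz_wrt N (\<lambda>x. ln (L + N x powr \<nu>))"
proof (rule lipschitz_wrt_compose_norm[OF N])
  have "L + t powr \<nu> \<noteq> 0" for t :: real
    using L powr_ge_zero[of t \<nu>] by linarith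
  then show "continuous_on {0..} (\<lambda>t. ln (L + t powr \<nu>))"
    using \<nu> by (intro continuous_on_ln continuous_on_add continuous_on_powr' continuous_on_const continuous_on_id) auto
  fix t :: real
  assume t: "t > 0"
  have pos: "L + t powr \<nu> > 0" using L powr_ge_zero[of t \<nu>] by linarith
  show "((\<lambda>t. ln (L + t powr \<nu>)) has_real_derivative \<nu> * (t powr (\<nu> - 1) / (L + t powr \<nu>))) (at t)"
    using pos t by (auto intro!: derivative_eq_intros)
  \<comment> \<open>Up to 1 the numerator is at most 1, because \<open>\<nu> \<ge> 1\<close>, and
    the denominator at least \<open>L\<close>; beyond 1 the numerator is at most
    \<open>t powr \<nu>\<close>. The sum of the two bounds serves both ranges.\<close>
  have "t powr (\<nu> - 1) / (L + t powr \<nu>) \<le> 1 / L + 1"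
  proof (cases "t \<le> 1")
    case True
    then have "t powr (\<nu> - 1) \<le> 1" using t \<nu> by (simp add: powr_le1)
    then have "t powr (\<nu> - 1) / (L + t powr \<nu>) \<le> 1 / L"
      using L by (intro frac_le) auto
    then show ?thesis by simp
  next
    case False
    then have "t powr (\<nu> - 1) \<le> t powr \<nu>" by (intro powr_mono) auto
    then have "t powr (\<nu> - 1) / (L + t powr \<nu>) \<le> 1"
      using L pos by (simp add: divide_le_eq)
    then show ?thesis using L by (simp add: add_increasing)
  qed
  then have "\<nu> * (t powr (\<nu> - 1) / (L + t powr \<nu>)) \<le> \<nu> * (1 / L + 1)"
    using \<nu> by (intro mult_left_mono) auto
  then show "\<bar>\<nu> * (t powr (\<nu> - 1) / (L + t powr \<nu>))\<bar> \<le> \<nu> * (1 / L + 1)"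
    using \<nu> pos by simp
qed

text \<open>After division by \<open>t\<close>, the numbers \<open>s / t\<close> and
  \<open>(t - s) / t\<close> lie in the unit interval and add up to 1. An exponent at most 1 does
  not decrease such numbers, so their powers add up to at least 1.\<close>

lemma powr_diff_le_powr:
  fixes s t :: real
  assumes "0 \<le> s" "s \<le> t" "0 \<le> \<nu>" "\<nu> \<le> 1"
  shows "t powr \<nu> - s powr \<nu> \<le> (t - s) powr \<nu>"
proof (cases "t = 0")
  case False
  then have t: "t > 0" using assms by simp
  have le: "a \<le> a powr \<nu>" if "0 \<le> a" "a \<le> 1" for a :: real
    using that assms powr_mono'[of \<nu> 1 a] by simp
  have "1 \<le> (s / t) powr \<nu> + ((t - s) / t) powr \<nu>"
    using le[of "s / t"] le[of "(t - s) / t"] assms t by (simp add: diff_divide_distrib)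
  then show ?thesis using assms t by (simp add: powr_divide divide_simps)
qed (use assms in simp)

text \<open>This replaces the Lipschitz property when \<open>\<nu> < 1\<close>: the power is Hoelder
  continuous, and the logarithm has slope at most \<open>1 / L\<close> on values of at least
  \<open>L\<close>.\<close>

lemma uniformly_continuous_wrt_ln_power_weight:
  assumes N: "is_norm N" and L: "(L::real) > 0" and \<nu>: "0 < \<nu>" "\<nu> \<le> 1"
  shows "uniformly_continuous_wrt N (\<lambda>x. ln (L + N x powr \<nu>))"
  unfolding uniformly_continuous_wrt_def
proof (intro allI impI)
  fix \<epsilon> :: real
  assume \<epsilon>: "\<epsilon> > 0"
  \<comment> \<open>Chosen so that the final bound \<open>\<delta> powr \<nu> / L\<close> equals
    \<open>\<epsilon>\<close>.\<close>
  define \<delta> where "\<delta> = (\<epsilon> * L) powr (1 / \<nu>)"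
  have "\<delta> > 0" and \<delta>: "\<delta> powr \<nu> = \<epsilon> * L"
    using \<epsilon> L \<nu> by (simp_all add: \<delta>_def powr_powr)
  have less: "\<bar>ln (L + t powr \<nu>) - ln (L + s powr \<nu>)\<bar> \<le> \<epsilon>"
    if "0 \<le> s" "s \<le> t" "t - s \<le> \<delta>" for s t :: real
  proof -
    have pos: "L + u powr \<nu> \<ge> L" "L + u powr \<nu> > 0" for u
      using L powr_ge_zero[of u \<nu>] by linarith+
    have mono: "s powr \<nu> \<le> t powr \<nu>" using that \<nu> by (intro powr_mono2) auto
    \<comment> \<open>The logarithm is concave, so it lies below its tangent at the smaller
      argument.\<close>
    have "ln (L + t powr \<nu>) - ln (L + s powr \<nu>)
        \<le> ((L + t powr \<nu>) - (L + s powr \<nu>)) / (L + s powr \<nu>)"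
      using pos(2) by (intro ln_diff_le) auto
    also have "\<dots> \<le> (t powr \<nu> - s powr \<nu>) / L"
      using mono pos L by (intro frac_le) auto
    also have "\<dots> \<le> (t - s) powr \<nu> / L"
      using powr_diff_le_powr[of s t \<nu>] that \<nu> L by (simp add: divide_right_mono)
    also have "\<dots> \<le> \<delta> powr \<nu> / L"
      using that \<nu> L by (intro divide_right_mono powr_mono2) auto
    finally have "ln (L + t powr \<nu>) - ln (L + s powr \<nu>) \<le> \<epsilon>" using \<delta> L by simp
    moreover have "ln (L + s powr \<nu>) \<le> ln (L + t powr \<nu>)"
      using mono pos(2)[of s] by (simp add: ln_mono)
    ultimately show ?thesis by simp
  qed
  have "\<bar>ln (L + N x powr \<nu>) - ln (L + N y powr \<nu>)\<bar> \<le> \<epsilon>" if "N (x - y) \<le> \<delta>" for x y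
  proof -
    have "\<bar>N x - N y\<bar> \<le> \<delta>" using is_norm_reverse_triangle[OF N, of x y] that by linarith
    then show ?thesis
      using less[of "N x" "N y"] less[of "N y" "N x"] is_norm_nonneg[OF N]
      by (cases "N x \<le> N y") (simp_all add: abs_minus_commute)
  qed
  then show "\<exists>\<delta>>0. \<forall>x y. N (x - y) \<le> \<delta> \<longrightarrow> \<bar>ln (L + N x powr \<nu>) - ln (L + N y powr \<nu>)\<bar> \<le> \<epsilon>"
    using \<open>\<delta> > 0\<close> by blast
qed

text \<open>The Lipschitz claim leaves out the power weight with \<open>\<nu> < 1\<close>, for which
  \<open>not_lipschitz_power_weight\<close> refutes it. Regularity covers all weights, as it rests
  only on uniform continuity of \<open>ln f\<close>.\<close>

theorem mainTheorem4:
  fixes N :: "real ^ 'd \<Rightarrow> real" and f :: "real ^ 'd \<Rightarrow> real" and c L \<nu> r :: real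
  assumes "is_norm N"
    and "c > 1" and "L > 0" and "\<nu> > 0" and "r > 0"
    and "f = (\<lambda>x. L) \<or>
         f = (\<lambda>x. ln (c + N x)) \<or>
         f = (\<lambda>x. L + N x powr \<nu>) \<or>
         f = (\<lambda>x. exp (N x / r))"
  shows "(\<not> (f = (\<lambda>x. L + N x powr \<nu>) \<and> \<nu> < 1) \<longrightarrow> lipschitz_wrt N (\<lambda>x. ln (f x)))
       \<and> RUC_regular N (max_set_fun f)"
proof -
  note N = \<open>is_norm N\<close>
  have pos: "f x > 0" for x
    using assms(2-6) is_norm_nonneg[OF N, of x] by (auto simp: add_pos_nonneg)
  have lip: "lipschitz_wrt N (\<lambda>x. ln (f x))" if "\<not> (f = (\<lambda>x. L + N x powr \<nu>) \<and> \<nu> < 1)"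
    using assms(6)
  proof (elim disjE)
    assume "f = (\<lambda>x. L)"
    then show ?thesis by (auto simp: lipschitz_wrt_def)
  next
    assume "f = (\<lambda>x. ln (c + N x))"
    then show ?thesis using lipschitz_wrt_ln_ln[OF N \<open>c > 1\<close>] by simp
  next
    assume "f = (\<lambda>x. L + N x powr \<nu>)"
    then show ?thesis using lipschitz_wrt_ln_power_weight[OF N \<open>L > 0\<close>] that by simp
  next
    assume f: "f = (\<lambda>x. exp (N x / r))"
    \<comment> \<open>The logarithm undoes the exponential and leaves a linear function of the norm
      with slope \<open>1 / r\<close>.\<close>
    have "lipschitz_wrt N (\<lambda>x. N x / r)"
      by (rule lipschitz_wrt_compose_norm[OF N, where g' = "\<lambda>t. 1 / r" and C = "1 / r"])
        (use \<open>r > 0\<close> in \<open>auto intro!: continuous_intros derivative_eq_intros\<close>)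
    then show ?thesis by (simp add: f)
  qed
  have "uniformly_continuous_wrt N (\<lambda>x. ln (f x))"
  proof (cases "f = (\<lambda>x. L + N x powr \<nu>) \<and> \<nu> < 1")
    case True
    then show ?thesis
      using uniformly_continuous_wrt_ln_power_weight[OF N \<open>L > 0\<close> \<open>\<nu> > 0\<close>] by simp
  qed (rule lipschitz_wrt_imp_uniformly_continuous_wrt[OF N lip])
  then show ?thesis using lip RUC_regular_max_set_fun[of N f, OF N pos] by blast
qed

end
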